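(* Let $Z$ and $T$ be random vectors in $\mathbb{R}^p$ with $P(T=\mathbf{0})=0$, and let $\theta\in\mathbb{R}^p$ be a constant vector. Suppose $L$ is a strictly convex (real-valued) function on $\mathbb{R}^p$ with $L(\mathbf{0})=0$. Let $m(Z)$ be a (scalar-valued) function of $Z$ such that, for each value $z$ of $Z$, $m(z)$ is a median of the conditional distribution given $Z=z$ of the univariate random variable $c^*$ defined by $$T^{\top}\,\nabla L\big(\theta-c^*T\big)=0 .$$ Then, for any other univariate (scalar-valued) function $k$ of $Z$, $$P\big[L\big(\theta-m(Z)T\big)<L\big(\theta-k(Z)T\big)\big]\ \ge\ \tfrac12\,P\big[k(Z)\ne m(Z)\big].$$
   Context: For a univariate random variable $W$, any number $m$ with $P(W<m)\le 1/2$ and $P(W\le m)\ge 1/2$ is called a median of $W$ (and similarly for conditional distributions). $\nabla L$ denotes the gradient of $L$. *)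

theory Defs
  imports "HOL-Probability.Probability"
begin

definition strictly_convex_on :: "'a::real_vector set \<Rightarrow> ('a \<Rightarrow> real) \<Rightarrow> bool" where
  "strictly_convex_on S f \<longleftrightarrow> convex S \<and>
     (\<forall>x\<in>S. \<forall>y\<in>S. \<forall>u>0. \<forall>v>0. x \<noteq> y \<longrightarrow> u + v = 1 \<longrightarrow>
        f (u *\<^sub>R x + v *\<^sub>R y) < u * f x + v * f y)"

text \<open>The gradient as a function; only meaningful at points where \<open>f\<close> is differentiable.\<close>

definition gradient :: "('a::real_inner \<Rightarrow> real) \<Rightarrow> 'a \<Rightarrow> 'a" where
  "gradient f x = (THE D. GDERIV f x :> D)"

text \<open>\<open>m\<close> is a median of a random variable with distribution \<open>\<mu>\<close>.\<close>

definition is_median :: "real measure \<Rightarrow> real \<Rightarrow> bool" where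
  "is_median \<mu> m \<longleftrightarrow> measure \<mu> {..<m} \<le> 1 / 2 \<and> measure \<mu> {..m} \<ge> 1 / 2"

text \<open>\<open>K\<close> is a regular conditional distribution of the random variable \<open>X\<close> (values in \<open>S\<close>)
  given \<open>Z\<close> (values in \<open>N\<close>): a probability kernel such that
  \<open>P(Z \<in> A, X \<in> B) = \<integral>\<^sub>A K(z)(B) P\<^sub>Z(dz)\<close>.\<close>

definition cond_distribution ::
  "'w measure \<Rightarrow> 'z measure \<Rightarrow> ('w \<Rightarrow> 'z) \<Rightarrow> 'x measure \<Rightarrow> ('w \<Rightarrow> 'x) \<Rightarrow> ('z \<Rightarrow> 'x measure) \<Rightarrow> bool" where
  "cond_distribution M N Z S X K \<longleftrightarrow>
     K \<in> N \<rightarrow>\<^sub>M prob_algebra S \<and>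
     (\<forall>A\<in>sets N. \<forall>B\<in>sets S.
        emeasure M {\<omega> \<in> space M. Z \<omega> \<in> A \<and> X \<omega> \<in> B}
          = (\<integral>\<^sup>+ z\<in>A. emeasure (K z) B \<partial>distr M N Z))"

end

theory Submission
  imports Defs
begin

text \<open>
  Along the line \<open>c \<mapsto> \<theta> - c T\<close> with \<open>T \<noteq> 0\<close> the function \<open>L\<close> is a strictly convex function of
  one real variable, and \<open>cstar\<close> is a critical point of it, hence its minimiser. A strictly convex
  function strictly decreases on the way to its minimiser, so \<open>m\<close> beats \<open>k\<close> whenever \<open>m\<close> lies
  between \<open>k\<close> and \<open>cstar\<close>, that is, whenever \<open>k < m \<le> cstar\<close> or \<open>cstar \<le> m < k\<close>
  (\<open>strictly_convex_on_less_towards_critical_point\<close>).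

  Which of \<open>k(Z) < m(Z)\<close> and \<open>m(Z) < k(Z)\<close> occurs is decided by \<open>Z\<close> alone. Given \<open>Z\<close>, the median
  property says that \<open>m(Z) \<le> cstar\<close> and \<open>cstar \<le> m(Z)\<close> each have conditional probability at
  least one half. Integrating over the values of \<open>Z\<close> of either kind
  (\<open>cond_distribution_ge_const\<close>) bounds the probability of each of the two disjoint favourable
  events from below, and the bounds add up to the claim. As \<open>m(Z)\<close> varies with \<open>Z\<close>, this
  integration needs the defining identity of a conditional distribution for arbitrary
  measurable sets of pairs, not only for rectangles (\<open>cond_distribution_emeasure\<close>).
\<close>

lemma strictly_convex_onD:
  assumes "strictly_convex_on S f" "x \<in> S" "y \<in> S" "x \<noteq> y" "0 < u" "0 < v" "u + v = 1"
  shows "f (u *\<^sub>R x + v *\<^sub>R y) < u * f x + v * f y"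
  using assms by (simp add: strictly_convex_on_def)

lemma strictly_convex_on_imp_convex_on:
  assumes "strictly_convex_on S f"
  shows "convex_on S f"
proof (rule convex_onI)
  show "convex S"
    using assms by (simp add: strictly_convex_on_def)
next
  fix t :: real and x y
  assume "0 < t" "t < 1" "x \<in> S" "y \<in> S"
  then show "f ((1 - t) *\<^sub>R x + t *\<^sub>R y) \<le> (1 - t) * f x + t * f y"
  proof (cases "x = y")
    case True
    have "(1 - t) *\<^sub>R y + t *\<^sub>R y = y"
      by (simp flip: scaleR_add_left)
    moreover have "(1 - t) * f y + t * f y = f y"
      by (simp add: algebra_simps)
    ultimately show ?thesis
      using True by simp
  next
    case False
    have "0 < 1 - t" "(1 - t) + t = 1"
      using \<open>t < 1\<close> by auto
    then show ?thesis
      using strictly_convex_onD[OF assms \<open>x \<in> S\<close> \<open>y \<in> S\<close> False _ \<open>0 < t\<close>] by (simp add: less_imp_le)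
  qed
qed

text \<open>The direction must be nonzero: otherwise the restriction is constant.\<close>

lemma strictly_convex_on_UNIV_along_line:
  assumes L: "strictly_convex_on UNIV L" and "v \<noteq> 0"
  shows "strictly_convex_on UNIV (\<lambda>c::real. L (a - c *\<^sub>R v))"
  unfolding strictly_convex_on_def
proof (intro conjI ballI allI impI)
  fix x y s t :: real
  assume *: "0 < s" "0 < t" "x \<noteq> y" "s + t = 1"
  have "a - (s *\<^sub>R x + t *\<^sub>R y) *\<^sub>R v = (s + t) *\<^sub>R a - (s *\<^sub>R x + t *\<^sub>R y) *\<^sub>R v"
    using * by simp
  also have "\<dots> = s *\<^sub>R (a - x *\<^sub>R v) + t *\<^sub>R (a - y *\<^sub>R v)"
    by (simp add: algebra_simps)
  finally show "L (a - (s *\<^sub>R x + t *\<^sub>R y) *\<^sub>R v) < s * L (a - x *\<^sub>R v) + t * L (a - y *\<^sub>R v)"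
    using L * \<open>v \<noteq> 0\<close> by (simp add: strictly_convex_on_def)
qed simp

text \<open>
  By the tangent inequality the critical point \<open>c\<close> is a minimiser, and strict convexity
  makes it the only one: a second minimiser would be beaten by the midpoint. A point strictly
  between \<open>k\<close> and \<open>c\<close> then has a value below a convex combination of \<open>f k\<close> and \<open>f c \<le> f k\<close>.
\<close>

lemma strictly_convex_on_less_towards_critical_point:
  fixes f :: "real \<Rightarrow> real"
  assumes f: "strictly_convex_on UNIV f"
    and deriv: "(f has_real_derivative 0) (at c)"
    and between: "m \<in> closed_segment k c" and "m \<noteq> k"
  shows "f m < f k"
proof -
  have min: "f c \<le> f x" for x
    using convex_on_imp_above_tangent[OF strictly_convex_on_imp_convex_on[OF f],
        where c = c and f' = 0 and x = x] deriv
    by simp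
  have "k \<noteq> c"
    using between \<open>m \<noteq> k\<close> by auto
  obtain u where u: "0 \<le> u" "u \<le> 1" "m = (1 - u) *\<^sub>R k + u *\<^sub>R c"
    using between by (auto simp: in_segment)
  have "u \<noteq> 0"
    using u \<open>m \<noteq> k\<close> by auto
  show ?thesis
  proof (cases "u = 1")
    case True
    have "f c \<le> f ((1/2) *\<^sub>R k + (1/2) *\<^sub>R c)"
      by (rule min)
    also have "\<dots> < (1/2) * f k + (1/2) * f c"
      using strictly_convex_onD[OF f _ _ \<open>k \<noteq> c\<close>, of "1/2" "1/2"] by simp
    finally show ?thesis
      using True u by simp
  next
    case False
    with u \<open>u \<noteq> 0\<close> have "0 < u" "0 < 1 - u" "(1 - u) + u = 1"
      by auto
    then have "f m < (1 - u) * f k + u * f c"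
      using strictly_convex_onD[OF f _ _ \<open>k \<noteq> c\<close>, of "1 - u" u] u(3) by simp
    also have "\<dots> \<le> (1 - u) * f k + u * f k"
      using min[of k] \<open>0 < u\<close> by simp
    finally show ?thesis
      by (simp add: algebra_simps)
  qed
qed

lemma differentiable_imp_GDERIV_gradient:
  fixes L :: "'a::euclidean_space \<Rightarrow> real"
  assumes "L differentiable (at x)"
  shows "GDERIV L x :> gradient L x"
proof -
  obtain L' where L': "(L has_derivative L') (at x)"
    using assms by (auto simp: differentiable_def)
  interpret L': bounded_linear L'
    by (rule has_derivative_bounded_linear[OF L'])
  have "L' h = h \<bullet> adjoint L' 1" for h
    using adjoint_works[OF L'.linear_axioms, of h 1] by simp
  then have "L' = (\<lambda>h. h \<bullet> adjoint L' 1)"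
    by blast
  with L' have D: "GDERIV L x :> adjoint L' 1"
    by (simp add: gderiv_def)
  show ?thesis
    unfolding gradient_def
  proof (rule theI[where P = "\<lambda>D. GDERIV L x :> D", OF D])
    fix D assume "GDERIV L x :> D"
    then have "(\<lambda>h. h \<bullet> D) = (\<lambda>h. h \<bullet> adjoint L' 1)"
      using D unfolding gderiv_def by (rule has_derivative_unique)
    then have "h \<bullet> D = h \<bullet> adjoint L' 1" for h
      by meson
    then show "D = adjoint L' 1"
      by (metis vector_eq_ldot)
  qed
qed

lemma has_real_derivative_along_line:
  fixes L :: "'a::euclidean_space \<Rightarrow> real"
  assumes "L differentiable (at (a - c *\<^sub>R v))"
  shows "((\<lambda>c. L (a - c *\<^sub>R v)) has_real_derivative - (v \<bullet> gradient L (a - c *\<^sub>R v))) (at c)"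
proof -
  have outer: "(L has_derivative (\<lambda>h. h \<bullet> gradient L (a - c *\<^sub>R v))) (at (a - c *\<^sub>R v))"
    using differentiable_imp_GDERIV_gradient[OF assms] by (simp add: gderiv_def)
  have inner: "((\<lambda>c. a - c *\<^sub>R v) has_derivative (\<lambda>h. - (h *\<^sub>R v))) (at c)"
    by (auto intro!: derivative_eq_intros)
  have "(\<lambda>h. - (h *\<^sub>R v) \<bullet> gradient L (a - c *\<^sub>R v)) = (*) (- (v \<bullet> gradient L (a - c *\<^sub>R v)))"
    by auto
  with has_derivative_compose[OF inner outer] show ?thesis
    by (simp only: has_field_derivative_def)
qed

text \<open>
  Both sides are finite measures of \<open>C\<close>, the right-hand side being the measure \<open>\<nu>\<close> of the
  experiment that draws \<open>z\<close> from the law of \<open>Z\<close> and then \<open>x\<close> from \<open>K z\<close>. They agree on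
  rectangles by definition, and rectangles form an intersection-stable generator.
\<close>

lemma cond_distribution_emeasure:
  assumes "prob_space M"
    and Z[measurable]: "Z \<in> M \<rightarrow>\<^sub>M N" and X[measurable]: "X \<in> M \<rightarrow>\<^sub>M S"
    and K: "cond_distribution M N Z S X K"
    and C: "C \<in> sets (N \<Otimes>\<^sub>M S)"
  shows "emeasure M {\<omega> \<in> space M. (Z \<omega>, X \<omega>) \<in> C}
    = (\<integral>\<^sup>+ z. emeasure (K z) (Pair z -` C) \<partial>distr M N Z)"
proof -
  interpret prob_space M by fact
  have Kmeas: "K \<in> N \<rightarrow>\<^sub>M prob_algebra S"
    using K by (simp add: cond_distribution_def)
  have [measurable]: "K \<in> N \<rightarrow>\<^sub>M subprob_algebra S"
    by (rule measurable_prob_algebraD[OF Kmeas])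
  have sets_K: "sets (K z) = sets S" if "z \<in> space N" for z
    using measurable_space[OF Kmeas that] by (simp add: space_prob_algebra)
  have Pair_K: "Pair z \<in> K z \<rightarrow>\<^sub>M N \<Otimes>\<^sub>M S" if "z \<in> space N" for z
    using that measurable_Pair1'[OF that, of S] by (simp cong: measurable_cong_sets add: sets_K)
  define \<nu> where "\<nu> = distr M N Z \<bind> (\<lambda>z. distr (K z) (N \<Otimes>\<^sub>M S) (Pair z))"
  have kernel: "(\<lambda>z. distr (K z) (N \<Otimes>\<^sub>M S) (Pair z)) \<in> distr M N Z \<rightarrow>\<^sub>M subprob_algebra (N \<Otimes>\<^sub>M S)"
    by (rule measurable_distr2[where M = S]) (simp_all add: measurable_split_conv)
  have space_N: "space (distr M N Z) \<noteq> {}"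
    using measurable_space[OF Z] not_empty by auto
  have \<nu>: "emeasure \<nu> D = (\<integral>\<^sup>+ z. emeasure (K z) (Pair z -` D) \<partial>distr M N Z)"
    if D: "D \<in> sets (N \<Otimes>\<^sub>M S)" for D
    unfolding \<nu>_def emeasure_bind[OF space_N kernel D]
  proof (rule nn_integral_cong)
    fix z assume "z \<in> space (distr M N Z)"
    then have z: "z \<in> space N" by simp
    have "Pair z -` D \<subseteq> space S"
      using sets.sets_into_space[OF D] by (auto simp: space_pair_measure)
    then show "emeasure (distr (K z) (N \<Otimes>\<^sub>M S) (Pair z)) D = emeasure (K z) (Pair z -` D)"
      using sets_eq_imp_space_eq[OF sets_K[OF z]]
      by (simp add: emeasure_distr[OF Pair_K[OF z] D] Int_absorb2)
  qed
  have "distr M (N \<Otimes>\<^sub>M S) (\<lambda>\<omega>. (Z \<omega>, X \<omega>)) = \<nu>"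
  proof (rule measure_eqI_generator_eq[OF Int_stable_pair_measure_generator[of N S],
        where \<Omega> = "space N \<times> space S" and A = "\<lambda>_. space N \<times> space S"])
    show "{a \<times> b |a b. a \<in> sets N \<and> b \<in> sets S} \<subseteq> Pow (space N \<times> space S)"
      by (auto dest: sets.sets_into_space)
    show "sets (distr M (N \<Otimes>\<^sub>M S) (\<lambda>\<omega>. (Z \<omega>, X \<omega>)))
      = sigma_sets (space N \<times> space S) {a \<times> b |a b. a \<in> sets N \<and> b \<in> sets S}"
      by (simp add: sets_pair_measure)
    show "sets \<nu> = sigma_sets (space N \<times> space S) {a \<times> b |a b. a \<in> sets N \<and> b \<in> sets S}"
      unfolding \<nu>_def using sets_bind[OF sets_kernel[OF kernel] space_N]
      by (simp add: sets_pair_measure)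
    show "emeasure (distr M (N \<Otimes>\<^sub>M S) (\<lambda>\<omega>. (Z \<omega>, X \<omega>))) (space N \<times> space S) \<noteq> \<infinity>"
      by (simp add: emeasure_distr)
  next
    fix R assume "R \<in> {a \<times> b |a b. a \<in> sets N \<and> b \<in> sets S}"
    then obtain A B where R: "R = A \<times> B" and AB[measurable]: "A \<in> sets N" "B \<in> sets S"
      by auto
    have "emeasure (distr M (N \<Otimes>\<^sub>M S) (\<lambda>\<omega>. (Z \<omega>, X \<omega>))) R
      = emeasure M {\<omega> \<in> space M. Z \<omega> \<in> A \<and> X \<omega> \<in> B}"
      unfolding R by (subst emeasure_distr) (auto intro!: arg_cong[where f = "emeasure M"])
    also have "\<dots> = (\<integral>\<^sup>+ z\<in>A. emeasure (K z) B \<partial>distr M N Z)"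
      using K AB by (simp add: cond_distribution_def)
    also have "\<dots> = (\<integral>\<^sup>+ z. emeasure (K z) (Pair z -` R) \<partial>distr M N Z)"
      by (rule nn_integral_cong) (auto simp: R indicator_def)
    also have "\<dots> = emeasure \<nu> R"
      unfolding R by (rule \<nu>[symmetric]) simp
    finally show "emeasure (distr M (N \<Otimes>\<^sub>M S) (\<lambda>\<omega>. (Z \<omega>, X \<omega>))) R = emeasure \<nu> R" .
  qed auto
  then have "emeasure (distr M (N \<Otimes>\<^sub>M S) (\<lambda>\<omega>. (Z \<omega>, X \<omega>))) C
      = (\<integral>\<^sup>+ z. emeasure (K z) (Pair z -` C) \<partial>distr M N Z)"
    using \<nu>[OF C] by simp
  then show ?thesis
    using C by (simp add: emeasure_distr vimage_def Int_def conj_commute)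
qed

text \<open>Given \<open>Z = z\<close>, the event is that \<open>X\<close> falls into the section of \<open>C\<close> at \<open>z\<close>.\<close>

lemma cond_distribution_ge_const:
  assumes M: "prob_space M"
    and Z[measurable]: "Z \<in> M \<rightarrow>\<^sub>M N" and X[measurable]: "X \<in> M \<rightarrow>\<^sub>M S"
    and K: "cond_distribution M N Z S X K"
    and A[measurable]: "A \<in> sets N" and C[measurable]: "C \<in> sets (N \<Otimes>\<^sub>M S)"
    and "0 \<le> q" and sections: "AE z in distr M N Z. q \<le> measure (K z) (Pair z -` C)"
  shows "q * measure M {\<omega> \<in> space M. Z \<omega> \<in> A}
    \<le> measure M {\<omega> \<in> space M. Z \<omega> \<in> A \<and> (Z \<omega>, X \<omega>) \<in> C}"
proof -
  interpret prob_space M by fact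
  have Kmeas: "K \<in> N \<rightarrow>\<^sub>M prob_algebra S"
    using K by (simp add: cond_distribution_def)
  have "ennreal q * emeasure M {\<omega> \<in> space M. Z \<omega> \<in> A}
      = (\<integral>\<^sup>+ z. ennreal q * indicator A z \<partial>distr M N Z)"
    by (simp add: nn_integral_cmult_indicator emeasure_distr vimage_def Int_def conj_commute)
  also have "\<dots> \<le> (\<integral>\<^sup>+ z. emeasure (K z) (Pair z -` (C \<inter> A \<times> space S)) \<partial>distr M N Z)"
  proof (rule nn_integral_mono_AE, use sections AE_space in eventually_elim)
    fix z assume q: "q \<le> measure (K z) (Pair z -` C)" and "z \<in> space (distr M N Z)"
    then have "K z \<in> space (prob_algebra S)"
      using measurable_space[OF Kmeas, of z] by simp
    then interpret Kz: prob_space "K z"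
      by (simp add: space_prob_algebra)
    have "Pair z -` (C \<inter> A \<times> space S) = Pair z -` C" if "z \<in> A"
      using that sets.sets_into_space[OF C] by (auto simp: space_pair_measure)
    then show "ennreal q * indicator A z \<le> emeasure (K z) (Pair z -` (C \<inter> A \<times> space S))"
      using q by (cases "z \<in> A") (auto simp: Kz.emeasure_eq_measure intro: ennreal_leI)
  qed
  also have "\<dots> = emeasure M {\<omega> \<in> space M. (Z \<omega>, X \<omega>) \<in> C \<inter> A \<times> space S}"
    by (rule cond_distribution_emeasure[OF M Z X K, symmetric]) simp
  also have "{\<omega> \<in> space M. (Z \<omega>, X \<omega>) \<in> C \<inter> A \<times> space S}
      = {\<omega> \<in> space M. Z \<omega> \<in> A \<and> (Z \<omega>, X \<omega>) \<in> C}"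
    using measurable_space[OF X] by auto
  finally show ?thesis
    using \<open>0 \<le> q\<close> by (simp add: emeasure_eq_measure flip: ennreal_mult)
qed

theorem lemma1p1:
  fixes M :: "'w measure"
    and Z T :: "'w \<Rightarrow> real ^ 'p"
    and \<theta> :: "real ^ 'p"
    and L :: "real ^ 'p \<Rightarrow> real"
    and cstar :: "'w \<Rightarrow> real"
    and K :: "real ^ 'p \<Rightarrow> real measure"
    and m k :: "real ^ 'p \<Rightarrow> real"
  assumes "prob_space M"
    and "Z \<in> M \<rightarrow>\<^sub>M borel"
    and "T \<in> M \<rightarrow>\<^sub>M borel"
    and "measure M {\<omega> \<in> space M. T \<omega> = 0} = 0"
    and "strictly_convex_on UNIV L"
    and "L 0 = 0"
    and "cstar \<in> M \<rightarrow>\<^sub>M borel"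
    and "AE \<omega> in M. L differentiable (at (\<theta> - cstar \<omega> *\<^sub>R T \<omega>)) \<and>
           T \<omega> \<bullet> gradient L (\<theta> - cstar \<omega> *\<^sub>R T \<omega>) = 0"
    and "cond_distribution M borel Z borel cstar K"
    and "m \<in> borel \<rightarrow>\<^sub>M borel"
    and "AE z in distr M borel Z. is_median (K z) (m z)"
    and "k \<in> borel \<rightarrow>\<^sub>M borel"
  shows "measure M {\<omega> \<in> space M. L (\<theta> - m (Z \<omega>) *\<^sub>R T \<omega>) < L (\<theta> - k (Z \<omega>) *\<^sub>R T \<omega>)}
           \<ge> 1 / 2 * measure M {\<omega> \<in> space M. k (Z \<omega>) \<noteq> m (Z \<omega>)}"
proof -
  interpret prob_space M by fact
  note [measurable] = assms(2,3,7,10,12)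
  let ?W = "{\<omega> \<in> space M. L (\<theta> - m (Z \<omega>) *\<^sub>R T \<omega>) < L (\<theta> - k (Z \<omega>) *\<^sub>R T \<omega>)}"
  let ?U = "{\<omega> \<in> space M. k (Z \<omega>) < m (Z \<omega>) \<and> m (Z \<omega>) \<le> cstar \<omega>}"
  let ?D = "{\<omega> \<in> space M. m (Z \<omega>) < k (Z \<omega>) \<and> cstar \<omega> \<le> m (Z \<omega>)}"
  have "continuous_on UNIV L"
    by (rule convex_on_continuous[OF open_UNIV strictly_convex_on_imp_convex_on[OF assms(5)]])
  then have L[measurable]: "L \<in> borel_measurable borel"
    by (rule borel_measurable_continuous_onI)
  have "AE \<omega> in M. T \<omega> \<noteq> 0"
    by (rule AE_I[where N = "{\<omega> \<in> space M. T \<omega> = 0}"])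
       (use assms(4) in \<open>auto simp: emeasure_eq_measure\<close>)
  with assms(8) have favourable: "AE \<omega> in M. \<omega> \<in> ?U \<union> ?D \<longrightarrow> \<omega> \<in> ?W"
  proof eventually_elim
    case (elim \<omega>)
    let ?f = "\<lambda>c. L (\<theta> - c *\<^sub>R T \<omega>)"
    have "strictly_convex_on UNIV ?f"
      using strictly_convex_on_UNIV_along_line assms(5) elim(2) by blast
    moreover have "(?f has_real_derivative 0) (at (cstar \<omega>))"
      using has_real_derivative_along_line[of L \<theta> "cstar \<omega>" "T \<omega>"] elim(1) by simp
    ultimately have "?f (m (Z \<omega>)) < ?f (k (Z \<omega>))"
      if "m (Z \<omega>) \<in> closed_segment (k (Z \<omega>)) (cstar \<omega>)" "m (Z \<omega>) \<noteq> k (Z \<omega>)"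
      using that strictly_convex_on_less_towards_critical_point by blast
    then show ?case
      by (auto simp: closed_segment_eq_real_ivl)
  qed
  have K_prob: "prob_space (K z)" and K_sets: "sets (K z) = sets borel" for z
    using measurable_space[of K borel "prob_algebra borel" z] assms(9)
    by (auto simp: cond_distribution_def space_prob_algebra)
  have closed_sides: "{p. m (fst p) \<le> snd p} \<in> sets (borel \<Otimes>\<^sub>M borel)"
      "{p. snd p \<le> m (fst p)} \<in> sets (borel \<Otimes>\<^sub>M borel)"
    using borel_measurable_le[of "\<lambda>p. m (fst p)" "borel \<Otimes>\<^sub>M borel" snd]
      borel_measurable_le[of snd "borel \<Otimes>\<^sub>M borel" "\<lambda>p. m (fst p)"]
    by (simp_all add: space_pair_measure)
  have upper: "AE z in distr M borel Z. 1/2 \<le> measure (K z) (Pair z -` {p. m (fst p) \<le> snd p})"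
    using assms(11)
  proof eventually_elim
    case (elim z)
    interpret Kz: prob_space "K z" by (rule K_prob)
    have "Pair z -` {p. m (fst p) \<le> snd p} = space (K z) - {..<m z}"
      using sets_eq_imp_space_eq[OF K_sets] by auto
    then show ?case
      using elim by (simp add: is_median_def Kz.prob_compl K_sets)
  qed
  have "1/2 * prob {\<omega> \<in> space M. Z \<omega> \<in> {z. k z < m z}}
      \<le> prob {\<omega> \<in> space M. Z \<omega> \<in> {z. k z < m z} \<and> (Z \<omega>, cstar \<omega>) \<in> {p. m (fst p) \<le> snd p}}"
    by (rule cond_distribution_ge_const[OF assms(1,2,7,9) _ closed_sides(1) _ upper]) simp_all
  then have U: "1/2 * prob {\<omega> \<in> space M. k (Z \<omega>) < m (Z \<omega>)} \<le> prob ?U"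
    by simp
  have lower: "AE z in distr M borel Z. 1/2 \<le> measure (K z) (Pair z -` {p. snd p \<le> m (fst p)})"
    using assms(11) by eventually_elim (simp add: is_median_def vimage_def atMost_def)
  have "1/2 * prob {\<omega> \<in> space M. Z \<omega> \<in> {z. m z < k z}}
      \<le> prob {\<omega> \<in> space M. Z \<omega> \<in> {z. m z < k z} \<and> (Z \<omega>, cstar \<omega>) \<in> {p. snd p \<le> m (fst p)}}"
    by (rule cond_distribution_ge_const[OF assms(1,2,7,9) _ closed_sides(2) _ lower]) simp_all
  then have D: "1/2 * prob {\<omega> \<in> space M. m (Z \<omega>) < k (Z \<omega>)} \<le> prob ?D"
    by simp
  have "{\<omega> \<in> space M. k (Z \<omega>) \<noteq> m (Z \<omega>)}
      = {\<omega> \<in> space M. k (Z \<omega>) < m (Z \<omega>)} \<union> {\<omega> \<in> space M. m (Z \<omega>) < k (Z \<omega>)}"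
    by auto
  then have "1/2 * prob {\<omega> \<in> space M. k (Z \<omega>) \<noteq> m (Z \<omega>)}
      \<le> 1/2 * (prob {\<omega> \<in> space M. k (Z \<omega>) < m (Z \<omega>)} + prob {\<omega> \<in> space M. m (Z \<omega>) < k (Z \<omega>)})"
    by (simp add: measure_Un_le)
  also have "\<dots> \<le> prob ?U + prob ?D"
    using U D by simp
  also have "\<dots> = prob (?U \<union> ?D)"
    by (rule finite_measure_Union[symmetric]) auto
  also have "\<dots> \<le> prob ?W"
    by (rule finite_measure_mono_AE[OF favourable]) simp
  finally show ?thesis .
qed

end
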